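(* Let $x\in X$ be fixed, and let $r,\beta\in(0,1]$. Consider the nested model $$ (\mathrm{A})\qquad \begin{aligned} \min_{z,\,v_k}\quad & z+\sum_{k=1}^K \frac{w_k}{r}\,v_k\\ \text{s.t.}\quad & z+v_k\ \ge\ \min_{z_k,\,y_{kj}}\Big\{\, z_k+\sum_{j=1}^J\frac{\pi_j}{\beta}\,y_{kj}\ :\ z_k+y_{kj}\ge f_k^j(x)\ \ \forall j,\ \ z_k\in\mathbb{R},\ y_{kj}\ge 0\ \ \forall j\Big\}\qquad k=1,\dots,K,\\ & z\in\mathbb{R},\quad v_k\ge 0\qquad k=1,\dots,K, \end{aligned} $$ with variables $(z,(v_k)_k)$, and the single-level linear program $$ (\mathrm{B})\qquad \begin{aligned} \min_{z,\,v_k,\,z_k,\,y_{kj}}\quad & z+\sum_{k=1}^K \frac{w_k}{r}\,v_k\\ \text{s.t.}\quad & z+v_k\ \ge\ z_k+\sum_{j=1}^J\frac{\pi_j}{\beta}\,y_{kj}\qquad k=1,\dots,K,\\ & z_k+y_{kj}\ge f_k^j(x)\qquad k=1,\dots,K,\ j=1,\dots,J,\\ & y_{kj}\ge 0\qquad k=1,\dots,K,\ j=1,\dots,J,\\ & z_k\in\mathbb{R},\quad v_k\ge 0\qquad k=1,\dots,K,\\ & z\in\mathbb{R}, \end{aligned} $$ with variables $(z,(v_k)_k,(z_k)_k,(y_{kj})_{k,j})$. Then the optimal objective values of (A) and (B) coincide, and their optimal solutions coincide in the common variables: $(z,(v_k)_k)$ is an optimal solution of (A) if and only if there exist $(z_k)_k$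 and $(y_{kj})_{k,j}$ such that $(z,(v_k)_k,(z_k)_k,(y_{kj})_{k,j})$ is an optimal solution of (B).
   Context: $X$ is a feasible set. There are $K$ criteria (objectives) with importances $w_1,\dots,w_K\ge 0$, $\sum_{k=1}^K w_k=1$, and $J$ scenarios with probabilities $\pi_1,\dots,\pi_J\ge 0$, $\sum_{j=1}^J\pi_j=1$. For each criterion $k$ and scenario $j$, $f_k^j:X\to\mathbb{R}$ is a real-valued function to be minimized. The numbers $r,\beta\in(0,1]$ are parameters. *)

theory Defs
  imports Complex_Main "HOL-Library.Extended_Real"
begin

text \<open>A minimisation problem is given by its set \<open>S\<close> of feasible points and its objective.\<close>

definition optimal_solution :: "'a set \<Rightarrow> ('a \<Rightarrow> real) \<Rightarrow> 'a \<Rightarrow> bool" where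
  "optimal_solution S obj s \<longleftrightarrow> s \<in> S \<and> (\<forall>t\<in>S. obj s \<le> obj t)"

text \<open>Taking the infimum in the extended reals makes the value meaningful without presupposing
  that the problem is feasible, bounded or attained; whenever there is an optimal
  solution it is the minimum, see \<open>opt_value_eq\<close>.\<close>

definition opt_value :: "'a set \<Rightarrow> ('a \<Rightarrow> real) \<Rightarrow> ereal" where
  "opt_value S obj = (INF s\<in>S. ereal (obj s))"

text \<open>Criteria and scenarios range over the finite types \<open>'k\<close> and \<open>'j\<close>.
  In the inner problem \<open>c j\<close> stands for the value of one criterion in scenario \<open>j\<close>;
  \<open>f k j x\<close> is $f_k^j(x)$, \<open>p j\<close> is $\pi_j$, and in \<open>B_feasible\<close> \<open>zk\<close> is the family $(z_k)_k$.\<close>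

definition inner_feasible :: "('j::finite \<Rightarrow> real) \<Rightarrow> (real \<times> ('j \<Rightarrow> real)) set" where
  "inner_feasible c = {(t, y). (\<forall>j. t + y j \<ge> c j) \<and> (\<forall>j. y j \<ge> 0)}"

definition inner_obj :: "('j::finite \<Rightarrow> real) \<Rightarrow> real \<Rightarrow> real \<times> ('j \<Rightarrow> real) \<Rightarrow> real" where
  "inner_obj p \<beta> = (\<lambda>(t, y). t + (\<Sum>j\<in>UNIV. p j / \<beta> * y j))"

definition A_feasible ::
  "('k::finite \<Rightarrow> 'j::finite \<Rightarrow> 'x \<Rightarrow> real) \<Rightarrow> ('j \<Rightarrow> real) \<Rightarrow> real \<Rightarrow> 'x \<Rightarrow>
    (real \<times> ('k \<Rightarrow> real)) set" where
  "A_feasible f p \<beta> x = {(z, v).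
     (\<forall>k. ereal (z + v k) \<ge> opt_value (inner_feasible (\<lambda>j. f k j x)) (inner_obj p \<beta>)) \<and>
     (\<forall>k. v k \<ge> 0)}"

definition A_obj :: "('k::finite \<Rightarrow> real) \<Rightarrow> real \<Rightarrow> real \<times> ('k \<Rightarrow> real) \<Rightarrow> real" where
  "A_obj w r = (\<lambda>(z, v). z + (\<Sum>k\<in>UNIV. w k / r * v k))"

definition B_feasible ::
  "('k::finite \<Rightarrow> 'j::finite \<Rightarrow> 'x \<Rightarrow> real) \<Rightarrow> ('j \<Rightarrow> real) \<Rightarrow> real \<Rightarrow> 'x \<Rightarrow>
    (real \<times> ('k \<Rightarrow> real) \<times> ('k \<Rightarrow> real) \<times> ('k \<Rightarrow> 'j \<Rightarrow> real)) set" where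
  "B_feasible f p \<beta> x = {(z, v, zk, y).
     (\<forall>k. z + v k \<ge> zk k + (\<Sum>j\<in>UNIV. p j / \<beta> * y k j)) \<and>
     (\<forall>k j. zk k + y k j \<ge> f k j x) \<and>
     (\<forall>k j. y k j \<ge> 0) \<and>
     (\<forall>k. v k \<ge> 0)}"

definition B_obj :: "('k::finite \<Rightarrow> real) \<Rightarrow> real \<Rightarrow>
    real \<times> ('k \<Rightarrow> real) \<times> ('k \<Rightarrow> real) \<times> ('k \<Rightarrow> 'j \<Rightarrow> real) \<Rightarrow> real" where
  "B_obj w r = (\<lambda>(z, v, zk, y). z + (\<Sum>k\<in>UNIV. w k / r * v k))"

lemma opt_value_eq: "optimal_solution S obj s \<Longrightarrow> opt_value S obj = ereal (obj s)"
  unfolding optimal_solution_def opt_value_def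
  by (intro antisym INF_lower INF_greatest) auto

text \<open>Under the standing assumptions the inner problem and the nested problem (\<open>A_feasible\<close>, \<open>A_obj\<close>) attain their
  infima, so that both are genuine minima.\<close>

lemma inner_attained:
  fixes c p :: "'j::finite \<Rightarrow> real"
  assumes p: "\<And>j. p j \<ge> 0" "(\<Sum>j\<in>UNIV. p j) = 1" and b: "0 < \<beta>" "\<beta> \<le> 1"
  shows "\<exists>s. optimal_solution (inner_feasible c) (inner_obj p \<beta>) s"
proof -
  define g where "g t = t + (\<Sum>j\<in>UNIV. p j / \<beta> * max 0 (c j - t))" for t
  define l where "l = Min (range c)"
  define u where "u = Max (range c)"
  have lu: "l \<le> c j" "c j \<le> u" for j unfolding l_def u_def by auto
  have "l \<le> u" using lu order_trans by blast
  moreover have "continuous_on {l..u} g" unfolding g_def by (intro continuous_intros)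
  ultimately obtain t0 where t0: "t0 \<in> {l..u}" "\<And>t. t \<in> {l..u} \<Longrightarrow> g t0 \<le> g t"
    using continuous_attains_inf[of "{l..u}" g] by fastforce
  have all: "g t0 \<le> g t" for t
  proof -
    consider "t < l" | "t \<in> {l..u}" | "t > u" by fastforce
    then show ?thesis
    proof cases
      case 1
      have eq: "g s = s + ((\<Sum>j\<in>UNIV. p j * c j) - s) / \<beta>" if "s \<le> l" for s
      proof -
        have "(\<Sum>j\<in>UNIV. p j / \<beta> * max 0 (c j - s)) = (\<Sum>j\<in>UNIV. (p j * c j - p j * s) / \<beta>)"
        proof (rule sum.cong)
          fix j
          have "max 0 (c j - s) = c j - s" using that lu(1)[of j] by simp
          then show "p j / \<beta> * max 0 (c j - s) = (p j * c j - p j * s) / \<beta>"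
            by (simp add: right_diff_distrib diff_divide_distrib)
        qed simp
        also have "\<dots> = ((\<Sum>j\<in>UNIV. p j * c j) - (\<Sum>j\<in>UNIV. p j) * s) / \<beta>"
          by (simp add: sum_divide_distrib sum_subtractf sum_distrib_right diff_divide_distrib)
        finally show ?thesis unfolding g_def using p(2) by simp
      qed
      have "(l - t) * 1 \<le> (l - t) * (1 / \<beta>)" using 1 b by (intro mult_left_mono) auto
      then have "g l \<le> g t" using 1 eq[of l] eq[of t] by (simp add: diff_divide_distrib)
      then show ?thesis using t0(2)[of l] \<open>l \<le> u\<close> by simp
    next
      case 2 then show ?thesis using t0 by blast
    next
      case 3
      have eq: "g s = s" if "s \<ge> u" for s
      proof -
        have "max 0 (c j - s) = 0" for j using lu(2)[of j] that by simp
        then show ?thesis unfolding g_def by simp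
      qed
      show ?thesis using t0(2)[of u] \<open>l \<le> u\<close> eq[of u] eq[of t] 3 by simp
    qed
  qed
  have low: "g t \<le> inner_obj p \<beta> (t, y)" if "(t, y) \<in> inner_feasible c" for t y
    unfolding g_def inner_obj_def
    using that p b by (auto simp: inner_feasible_def algebra_simps intro!: sum_mono mult_left_mono divide_right_mono)
  have "optimal_solution (inner_feasible c) (inner_obj p \<beta>) (t0, \<lambda>j. max 0 (c j - t0))"
    unfolding optimal_solution_def
  proof (intro conjI ballI)
    show "(t0, \<lambda>j. max 0 (c j - t0)) \<in> inner_feasible c" by (auto simp: inner_feasible_def)
    fix s assume "s \<in> inner_feasible c"
    then show "inner_obj p \<beta> (t0, \<lambda>j. max 0 (c j - t0)) \<le> inner_obj p \<beta> s"
      using low[of "fst s" "snd s"] all[of "fst s"] by (simp add: g_def inner_obj_def)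
  qed
  then show ?thesis by blast
qed

lemma A_attained:
  fixes f :: "'k::finite \<Rightarrow> 'j::finite \<Rightarrow> 'x \<Rightarrow> real"
  assumes w: "\<And>k. w k \<ge> 0" "(\<Sum>k\<in>UNIV. w k) = 1" and p: "\<And>j. p j \<ge> 0" "(\<Sum>j\<in>UNIV. p j) = 1"
    and r: "0 < r" "r \<le> 1" and b: "0 < \<beta>" "\<beta> \<le> 1"
  shows "\<exists>s. optimal_solution (A_feasible f p \<beta> x) (A_obj w r) s"
proof -
  have "\<forall>k. \<exists>q. opt_value (inner_feasible (\<lambda>j. f k j x)) (inner_obj p \<beta>) = ereal q"
    using inner_attained[OF p b] opt_value_eq by metis
  then obtain q where q: "\<And>k. opt_value (inner_feasible (\<lambda>j. f k j x)) (inner_obj p \<beta>) = ereal (q k)"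
    by metis
  have "A_feasible f p \<beta> x = inner_feasible q"
    unfolding A_feasible_def q by (simp add: inner_feasible_def)
  moreover have "A_obj w r = inner_obj w r" by (simp add: A_obj_def inner_obj_def)
  ultimately show ?thesis using inner_attained[OF w r] by metis
qed

end

theory Submission imports Defs begin

text \<open>The inner problem attains its minimum, so \<open>z + v k\<close> is at least its value iff some feasible
  inner point has cost at most \<open>z + v k\<close>. Choosing one such point per criterion shows that the
  feasible set of (A) is the projection of that of (B), and the objective factors through this
  projection.\<close>

lemma opt_value_image: "opt_value (h ` T) g = opt_value T (g \<circ> h)"
  by (simp add: opt_value_def image_image)

lemma optimal_solution_image:
  \<comment> \<open>On the image, \<open>g\<close> takes exactly the values that
    \<open>g \<circ> h\<close> takes on \<open>T\<close>, so an optimum lifts to each of its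
    preimages in \<open>T\<close>.\<close>
  "optimal_solution (h ` T) g s \<longleftrightarrow> (\<exists>t. h t = s \<and> optimal_solution T (g \<circ> h) t)"
  by (auto simp: optimal_solution_def)

text \<open>Attainment decides the boundary case: when \<open>a\<close> equals the infimum, the
  minimiser \<open>s\<close> is the witness \<open>t\<close>, and an unattained infimum would leave
  none.\<close>

lemma opt_value_le_iff:
  assumes "optimal_solution S obj s"
  shows "opt_value S obj \<le> ereal a \<longleftrightarrow> (\<exists>t\<in>S. obj t \<le> a)"
  unfolding opt_value_eq[OF assms] using assms
  by (meson optimal_solution_def ereal_less_eq(3) order_trans)

definition B_proj :: "real \<times> ('k \<Rightarrow> real) \<times> ('k \<Rightarrow> real) \<times> ('k \<Rightarrow> 'j \<Rightarrow> real) \<Rightarrow> real \<times> ('k \<Rightarrow> real)" where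
  "B_proj = (\<lambda>(z, v, zk, y). (z, v))"

lemma B_obj_eq: "B_obj w r = A_obj w r \<circ> B_proj"
  by (auto simp: B_obj_def A_obj_def B_proj_def)

lemma A_feasible_eq_proj:
  fixes f :: "'k::finite \<Rightarrow> 'j::finite \<Rightarrow> 'x \<Rightarrow> real"
  assumes p: "\<And>j. p j \<ge> 0" "(\<Sum>j\<in>UNIV. p j) = 1" and b: "0 < \<beta>" "\<beta> \<le> 1"
  shows "A_feasible f p \<beta> x = B_proj ` B_feasible f p \<beta> x"
proof (rule set_eqI)
  fix s :: "real \<times> ('k \<Rightarrow> real)"
  obtain z v where s: "s = (z, v)" by fastforce
  let ?S = "\<lambda>k. inner_feasible (\<lambda>j. f k j x)"
  have "opt_value (?S k) (inner_obj p \<beta>) \<le> ereal a \<longleftrightarrow> (\<exists>t\<in>?S k. inner_obj p \<beta> t \<le> a)" for k a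
    using inner_attained[OF p b] by (metis opt_value_le_iff)
  then have "s \<in> A_feasible f p \<beta> x \<longleftrightarrow>
      (\<forall>k. \<exists>t y. (t, y) \<in> ?S k \<and> inner_obj p \<beta> (t, y) \<le> z + v k) \<and> (\<forall>k. v k \<ge> 0)"
    by (simp add: s A_feasible_def Bex_def)
  also have "\<dots> \<longleftrightarrow> (\<exists>zk y. (z, v, zk, y) \<in> B_feasible f p \<beta> x)"
    \<comment> \<open>For fixed \<open>z\<close> and \<open>v\<close> the constraints of (B)
      decouple over \<open>k\<close>, so inner points chosen separately for each criterion assemble
      into the families \<open>zk\<close> and \<open>y\<close>.\<close>
    unfolding choice_iff
    by (simp add: B_feasible_def inner_feasible_def inner_obj_def all_conj_distrib conj_ac)
  also have "\<dots> \<longleftrightarrow> s \<in> B_proj ` B_feasible f p \<beta> x"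
    by (simp add: s B_proj_def image_iff Bex_def)
  finally show "s \<in> A_feasible f p \<beta> x \<longleftrightarrow> s \<in> B_proj ` B_feasible f p \<beta> x" .
qed

theorem proposition2:
  fixes X :: "'x set"
    and f :: "'k::finite \<Rightarrow> 'j::finite \<Rightarrow> 'x \<Rightarrow> real"
    and w :: "'k \<Rightarrow> real" and p :: "'j \<Rightarrow> real"
    and r \<beta> :: real and x :: 'x
  assumes "\<And>k. w k \<ge> 0" and "(\<Sum>k\<in>UNIV. w k) = 1"
    and "\<And>j. p j \<ge> 0" and "(\<Sum>j\<in>UNIV. p j) = 1"
    and "r \<in> {0<..1}" and "\<beta> \<in> {0<..1}"
    and "x \<in> X"
  shows "opt_value (A_feasible f p \<beta> x) (A_obj w r) = opt_value (B_feasible f p \<beta> x) (B_obj w r) \<and>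
    (\<forall>z v. optimal_solution (A_feasible f p \<beta> x) (A_obj w r) (z, v) \<longleftrightarrow>
       (\<exists>zk y. optimal_solution (B_feasible f p \<beta> x) (B_obj w r) (z, v, zk, y)))"
proof -
  have "A_feasible f p \<beta> x = B_proj ` B_feasible f p \<beta> x"
    using assms by (intro A_feasible_eq_proj) auto
  then show ?thesis
    \<comment> \<open>\<open>B_proj\<close> stays folded while the image lemmas rewrite; unfolding
      it afterwards turns a preimage of \<open>(z, v)\<close> into a choice of \<open>zk\<close> and
      \<open>y\<close>.\<close>
    by (simp add: opt_value_image optimal_solution_image B_obj_eq) (simp add: B_proj_def)
qed

end
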